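(* Let $\varphi:\{0,1\}^*\to\{0,1\}^*$ be a primitive uniform morphism and let $\mathbf{u}$ be an aperiodic fixed point of $\varphi$ such that $\mathbf{u}$ contains infinitely many antipalindromes as factors. Then $\varphi$ or $\varphi^2$ is conjugate to a morphism in class $\mathcal{A}_1$.
   Context: Words are finite sequences over the alphabet $\{0,1\}$; $\{0,1\}^*$ is the free monoid under concatenation with empty word $\varepsilon$. $\mathrm{E}$ is the antimorphism ($\mathrm{E}(uv)=\mathrm{E}(v)\mathrm{E}(u)$) with $\mathrm{E}(0)=1$, $\mathrm{E}(1)=0$, i.e. $\mathrm{E}(w_1\cdots w_n)=(1-w_n)\cdots(1-w_1)$; a word $w$ is an antipalindrome if $\mathrm{E}(w)=w$. A morphism $\varphi$ is primitive if there is $k$ such that every letter occurs in $\varphi^k(b)$ for every letter $b$; it is uniform if $|\varphi(0)|=|\varphi(1)|$. An infinite word $\mathbf{u}$ is a fixed point of $\varphi$ if $\varphi(\mathbf{u})=\mathbf{u}$ (with $\varphi$ extended letterwise to infinite words); $\mathbf{u}$ is aperiodic if it is not of the form $vw^\infty$ with $w\neq\varepsilon$. A morphism $\varphi$ is left conjugate to $\psi$ (and $\psi$ right conjugate to $\varphi$) if there is a word $q$ with $q\varphi(w)=\psi(w)q$ for all words $w$; two morphisms are conjugate if one is left conjugate to the other. A morphism $\varphi$ belongs to class $\mathcal{A}_1$ if there are words $\mathfrak{p},\mathfrak{s}$ with $\mathfrak{p}\neq\varepsilon$, $\mathfrak{s}$ an antipalindrome, $\varphi(0)=\mathfrak{p}\mathfrak{s}$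 and $\varphi(1)=\mathrm{E}(\mathfrak{p})\mathfrak{s}$. *)

theory Defs
  imports Main "HOL-Library.Stream"
begin

text \<open>
  The letters 0 and 1 are \<^term>\<open>False\<close> and \<^term>\<open>True\<close>, so that \<^term>\<open>Not\<close> is the exchange of
  letters. Finite words are lists and infinite words are streams.
\<close>

type_synonym word = "bool list"

definition E :: "word \<Rightarrow> word" where
  "E w = rev (map Not w)"

definition antipalindrome :: "word \<Rightarrow> bool" where
  "antipalindrome w \<longleftrightarrow> E w = w"

definition morphism :: "(word \<Rightarrow> word) \<Rightarrow> bool" where
  "morphism \<phi> \<longleftrightarrow> (\<forall>u v. \<phi> (u @ v) = \<phi> u @ \<phi> v)"

definition primitive_morphism :: "(word \<Rightarrow> word) \<Rightarrow> bool" where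
  "primitive_morphism \<phi> \<longleftrightarrow> morphism \<phi> \<and> (\<exists>k. \<forall>a b. a \<in> set ((\<phi> ^^ k) [b]))"

definition uniform_morphism :: "(word \<Rightarrow> word) \<Rightarrow> bool" where
  "uniform_morphism \<phi> \<longleftrightarrow> morphism \<phi> \<and> length (\<phi> [False]) = length (\<phi> [True])"

text \<open>
  The concatenation of the images of the letters. Because of the behaviour of \<^const>\<open>flat\<close> on
  empty lists, this is the intended extension only if no letter is erased, which holds for every
  primitive morphism; see the lemmas below.
\<close>

definition extend :: "(word \<Rightarrow> word) \<Rightarrow> bool stream \<Rightarrow> bool stream" where
  "extend \<phi> u = flat (smap (\<lambda>a. \<phi> [a]) u)"

definition fixed_point :: "(word \<Rightarrow> word) \<Rightarrow> bool stream \<Rightarrow> bool" where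
  "fixed_point \<phi> u \<longleftrightarrow> extend \<phi> u = u"

definition aperiodic :: "bool stream \<Rightarrow> bool" where
  "aperiodic u \<longleftrightarrow> \<not> (\<exists>v w. w \<noteq> [] \<and> u = v @- cycle w)"

definition factor :: "word \<Rightarrow> bool stream \<Rightarrow> bool" where
  "factor w u \<longleftrightarrow> (\<exists>v s. u = v @- w @- s)"

definition left_conjugate :: "(word \<Rightarrow> word) \<Rightarrow> (word \<Rightarrow> word) \<Rightarrow> bool" where
  "left_conjugate \<phi> \<psi> \<longleftrightarrow> (\<exists>q. \<forall>w. q @ \<phi> w = \<psi> w @ q)"

definition conjugate :: "(word \<Rightarrow> word) \<Rightarrow> (word \<Rightarrow> word) \<Rightarrow> bool" where
  "conjugate \<phi> \<psi> \<longleftrightarrow> left_conjugate \<phi> \<psi> \<or> left_conjugate \<psi> \<phi>"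

definition class_A1 :: "(word \<Rightarrow> word) \<Rightarrow> bool" where
  "class_A1 \<phi> \<longleftrightarrow> morphism \<phi> \<and>
     (\<exists>p s. p \<noteq> [] \<and> antipalindrome s \<and> \<phi> [False] = p @ s \<and> \<phi> [True] = E p @ s)"

lemma E_append: "E (u @ v) = E v @ E u"
  by (simp add: E_def)

lemma morphism_Nil: "morphism \<phi> \<Longrightarrow> \<phi> [] = []"
  unfolding morphism_def by (metis append_self_conv)

lemma primitive_morphism_nonerasing:
  assumes "primitive_morphism \<phi>"
  shows "\<phi> [a] \<noteq> []"
proof
  assume a: "\<phi> [a] = []"
  from assms obtain k where m: "morphism \<phi>" and k: "\<And>a b. a \<in> set ((\<phi> ^^ k) [b])"
    unfolding primitive_morphism_def by blast
  have nil: "(\<phi> ^^ n) [] = []" for n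
    by (induction n) (simp_all add: morphism_Nil[OF m])
  show False
  proof (cases k)
    case 0
    then show ?thesis using k[of True False] by simp
  next
    case (Suc n)
    then show ?thesis using k[of a a] a nil[of n] by (simp add: funpow_swap1)
  qed
qed

lemma extend_shift:
  assumes "morphism \<phi>" and "\<And>a. \<phi> [a] \<noteq> []"
  shows "extend \<phi> (w @- s) = \<phi> w @- extend \<phi> s"
proof (induction w)
  case Nil
  then show ?case by (simp add: morphism_Nil[OF assms(1)])
next
  case (Cons a w)
  have "\<phi> (a # w) = \<phi> [a] @ \<phi> w"
    using assms(1) unfolding morphism_def by (metis append_Cons append_Nil)
  then show ?case using Cons assms(2) by (simp add: extend_def)
qed

end

theory Submission
  imports Defs
begin

text \<open>
  Write the images of the letters as \<open>\<phi>(a) = x P\<^sub>a y\<close> with \<open>x\<close> and \<open>y\<close> maximal. By uniform recurrence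
  the factors of \<open>u\<close> are closed under \<^const>\<open>E\<close>, so long words \<open>E(\<phi>(v))\<close> occur in \<open>u\<close> and their
  blocks \<open>E(\<phi>(a))\<close> have to be read off \<open>u = \<phi>(u)\<close> at a constant phase. This forces \<open>y x\<close> to be an
  antipalindrome and \<open>E\<close> either to exchange \<open>P\<^sub>0\<close> and \<open>P\<^sub>1\<close> or to fix both. In the first case
  \<open>a \<mapsto> P\<^sub>a y x\<close> is a conjugate of \<open>\<phi>\<close> in class \<open>A\<^sub>1\<close>. In the second case the factors of \<open>u\<close> are also
  closed under reversal, hence under the exchange of letters; the same argument for the exchange
  gives \<open>x = y = \<epsilon>\<close> and that \<open>\<phi>(1)\<close> is the exchange of \<open>\<phi>(0)\<close>, so that \<open>\<phi>\<^sup>2\<close> is in class \<open>A\<^sub>1\<close>.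
\<close>

section \<open>Streams and occurrences of factors\<close>

lemma eq_cycleI:
  assumes "w \<noteq> []" "u = w @- u"
  shows "u = cycle w"
proof -
  have "u !! n = cycle w !! n" for n
  proof (induction n rule: less_induct)
    case (less n)
    show ?case
    proof (cases "n < length w")
      case True
      then show ?thesis
        using assms by (metis cycle_decomp shift_snth_less)
    next
      case False
      then have "n - length w < n" using assms(1) by (cases w) auto
      then have "u !! (n - length w) = cycle w !! (n - length w)" by (rule less)
      moreover have "u !! n = u !! (n - length w)"
        using False assms(2) by (metis not_less shift_snth_ge)
      moreover have "cycle w !! n = cycle w !! (n - length w)"
        using False assms(1) by (metis not_less shift_snth_ge cycle_decomp)
      ultimately show ?thesis by simp
    qed
  qed
  then have "snth u = snth (cycle w)" by blast
  then show ?thesis by (metis stream_smap_nats)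
qed

text \<open>Occurrences are tracked by position from here on, because the argument turns on
  positions modulo the block length.\<close>

lemma factor_iff_stake: "factor w u \<longleftrightarrow> (\<exists>n. stake (length w) (sdrop n u) = w)"
proof
  assume "factor w u"
  then obtain v s where "u = v @- w @- s" unfolding factor_def by blast
  then have "stake (length w) (sdrop (length v) u) = w"
    by (simp add: sdrop_shift stake_shift)
  then show "\<exists>n. stake (length w) (sdrop n u) = w" by blast
next
  assume "\<exists>n. stake (length w) (sdrop n u) = w"
  then obtain n where n: "stake (length w) (sdrop n u) = w" by blast
  have "u = stake n u @- stake (length w) (sdrop n u) @- sdrop (length w) (sdrop n u)"
    by (simp only: stake_sdrop)
  then show "factor w u" unfolding factor_def n by blast
qed

lemma factor_stake: "factor (stake m (sdrop n u)) u"
  unfolding factor_iff_stake by auto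

lemma factor_infix: "factor (a @ b @ c) u \<Longrightarrow> factor b u"
  unfolding factor_def by (metis shift_append)

lemma factor_extend:
  assumes "factor v u"
  shows "\<exists>v'. factor (v @ v') u \<and> length v' = n"
proof -
  from assms obtain k where k: "stake (length v) (sdrop k u) = v"
    unfolding factor_iff_stake by blast
  have "stake (length v + n) (sdrop k u) = v @ stake n (sdrop (length v) (sdrop k u))"
    by (metis k stake_add)
  then show ?thesis by (metis factor_stake length_stake)
qed

section \<open>Blocks of equal length and their common affixes\<close>

lemma length_concat_uniform:
  assumes "\<And>a. length (f a) = L"
  shows "length (concat (map f w)) = length w * L"
  by (induction w) (simp_all add: assms)

lemma nth_concat_uniform:
  assumes "\<And>a. length (f a) = L" "i < length w"
  shows "take L (drop (i * L) (concat (map f w))) = f (w ! i)"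
  using assms(2)
proof (induction w arbitrary: i)
  case (Cons a w)
  then show ?case by (cases i) (simp_all add: assms(1))
qed simp

text \<open>The words of the two equations first differ right after \<open>s\<close>, and also right
  after \<open>s'\<close>, so these prefixes have equal length.\<close>

lemma branching_prefix_unique:
  assumes eq: "s @ A @ p = s' @ A' @ p'" "s @ B @ p = s' @ B' @ p'"
    and ne: "A \<noteq> []" "B \<noteq> []" "A' \<noteq> []" "B' \<noteq> []"
    and hd: "hd A \<noteq> hd B" "hd A' \<noteq> hd B'"
  shows "s = s'"
proof -
  have "length s = length s'"
  proof (rule linorder_cases[of "length s" "length s'"])
    assume "length s < length s'"
    then have "hd A = s' ! length s" "hd B = s' ! length s"
      using arg_cong[OF eq(1), of "\<lambda>w. w ! length s"] arg_cong[OF eq(2), of "\<lambda>w. w ! length s"] ne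
      by (simp_all add: nth_append hd_conv_nth)
    then show ?thesis using hd by simp
  next
    assume "length s > length s'"
    then have "hd A' = s ! length s'" "hd B' = s ! length s'"
      using arg_cong[OF eq(1), of "\<lambda>w. w ! length s'"] arg_cong[OF eq(2), of "\<lambda>w. w ! length s'"] ne
      by (simp_all add: nth_append hd_conv_nth)
    then show ?thesis using hd by simp
  qed
  then show ?thesis using eq(1) by simp
qed

text \<open>\<open>x\<close> is the longest common prefix. The suffix \<open>y\<close> is then taken
  maximal in what remains, not in the whole words, so that it cannot overlap
  \<open>x\<close>.\<close>

lemma common_affix_decomp:
  fixes g :: "bool \<Rightarrow> 'a list"
  assumes "\<And>a. length (g a) = L" "g False \<noteq> g True"
  obtains x y P where "\<And>a. g a = x @ P a @ y" "P False \<noteq> []" "P True \<noteq> []"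
    "hd (P False) \<noteq> hd (P True)" "last (P False) \<noteq> last (P True)"
proof -
  obtain x a b A B where *: "g False = x @ a # A" "g True = x @ b # B" "a \<noteq> b"
    using same_length_different[OF assms(2)] assms(1) by auto
  have "rev (a # A) \<noteq> rev (b # B)" "length (rev (a # A)) = length (rev (b # B))"
    using assms(1)[of False] assms(1)[of True] * by auto
  from same_length_different[OF this] obtain z c d C D where
    **: "rev (a # A) = z @ c # C" "rev (b # B) = z @ d # D" "c \<noteq> d" by auto
  then have AB: "a # A = rev C @ c # rev z" "b # B = rev D @ d # rev z"
    by (metis (no_types, lifting) append.assoc append_Cons append_Nil rev.simps(2) rev_append rev_rev_ident)+
  define P where "P t = (if t then rev D @ [d] else rev C @ [c])" for t
  have len: "length C = length D"
    using arg_cong[OF AB(1), of length] arg_cong[OF AB(2), of length]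
      assms(1)[of False] assms(1)[of True] * by simp
  have "hd (P False) = a" "hd (P True) = b"
    using AB len by (cases "rev C"; cases "rev D"; auto simp: P_def)+
  then have "hd (P False) \<noteq> hd (P True)" using * by simp
  moreover have "g t = x @ P t @ rev z" for t
    using * AB by (cases t) (auto simp: P_def)
  ultimately show ?thesis using that[of x P "rev z"] ** by (auto simp: P_def)
qed

text \<open>If both pairs differed, the three concatenations would be pairwise distinct, but
  \<open>f\<close> has at most two values.\<close>

lemma affix_agree_of_two_blocks:
  fixes D T f :: "bool \<Rightarrow> 'a list"
  assumes len: "\<And>a. length (D a) = n"
    and e: "D False @ T True = f e1" "D True @ T False = f e2" "D c @ T c = f e3"
  shows "D False = D True \<or> T False = T True"
proof (rule ccontr)
  assume "\<not> ?thesis"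
  then have no: "D False \<noteq> D True" "T False \<noteq> T True" by blast+
  have inj: "D a @ T b = D a' @ T b' \<longleftrightarrow> D a = D a' \<and> T b = T b'" for a b a' b'
    by (simp add: len)
  have "f e1 \<noteq> f e2" unfolding e[symmetric] inj using no by simp
  moreover have "f e1 \<noteq> f e3" "f e2 \<noteq> f e3"
    unfolding e[symmetric] inj using no by (cases c; simp)+
  ultimately have "e1 \<noteq> e2" "e1 \<noteq> e3" "e2 \<noteq> e3" by blast+
  then show False by simp
qed

section \<open>Block structure of the fixed point\<close>

locale primitive_uniform_fixed_point =
  fixes \<phi> :: "word \<Rightarrow> word" and u :: "bool stream"
  assumes primitive: "primitive_morphism \<phi>" and uniform: "uniform_morphism \<phi>"
    and fixed: "fixed_point \<phi> u" and aperiodic: "aperiodic u"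
begin

definition L :: nat where "L = length (\<phi> [False])"

lemma image_append: "\<phi> (v @ w) = \<phi> v @ \<phi> w"
  using uniform unfolding uniform_morphism_def morphism_def by blast

lemma image_Nil: "\<phi> [] = []"
  using uniform morphism_Nil unfolding uniform_morphism_def by blast

lemma image_Cons: "\<phi> (a # v) = \<phi> [a] @ \<phi> v"
  using image_append[of "[a]" v] by simp

lemma eq_concat: "\<phi> w = concat (map (\<lambda>a. \<phi> [a]) w)"
proof (induction w)
  case (Cons a w)
  then show ?case using image_Cons[of a w] by simp
qed (simp add: image_Nil)

lemma length_letter: "length (\<phi> [a]) = L"
  using uniform unfolding L_def uniform_morphism_def by (cases a) auto

lemma length_image: "length (\<phi> w) = length w * L"
proof (induction w)
  case (Cons a w)
  then show ?case using image_Cons[of a w] by (simp add: length_letter)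
qed (simp add: image_Nil)

lemma length_funpow: "length ((\<phi> ^^ k) w) = length w * L ^ k"
  by (induction k) (simp_all add: length_image)

text \<open>With \<open>L\<close> at most 1, an iterated image of a letter has at most one letter
  and cannot contain both.\<close>

lemma L_ge_2: "2 \<le> L"
proof (rule ccontr)
  assume "\<not> 2 \<le> L"
  then have L: "L = 0 \<or> L = 1" by auto
  obtain k where k: "\<And>a b. a \<in> set ((\<phi> ^^ k) [b])"
    using primitive unfolding primitive_morphism_def by blast
  have "length ((\<phi> ^^ k) [False]) = L ^ k" by (simp add: length_funpow)
  moreover have "L ^ k \<le> 1" using L by (cases k) auto
  moreover have "card {False, True} \<le> card (set ((\<phi> ^^ k) [False]))"
    by (rule card_mono) (auto intro: k)
  ultimately show False using card_length[of "(\<phi> ^^ k) [False]"] by simp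
qed

lemma stake_eq: "\<phi> (stake n u) = stake (n * L) u"
proof -
  have "morphism \<phi>" using uniform unfolding uniform_morphism_def by blast
  moreover have "\<phi> [a] \<noteq> []" for a using primitive_morphism_nonerasing[OF primitive] .
  ultimately have "extend \<phi> (stake n u @- sdrop n u) = \<phi> (stake n u) @- extend \<phi> (sdrop n u)"
    by (rule extend_shift)
  then have "u = \<phi> (stake n u) @- extend \<phi> (sdrop n u)"
    using fixed unfolding fixed_point_def by (simp add: stake_sdrop)
  then have "stake (n * L) u = stake (n * L) (\<phi> (stake n u) @- extend \<phi> (sdrop n u))" by simp
  then show ?thesis by (simp add: stake_shift length_image)
qed

text \<open>By uniformity the images of the first \<open>n\<close> letters fill exactly the first
  \<open>n * L\<close> positions; cancelling this prefix leaves the image of the window.\<close>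

lemma window: "\<phi> (stake m (sdrop n u)) = stake (m * L) (sdrop (n * L) u)"
proof -
  have "\<phi> (stake n u) @ \<phi> (stake m (sdrop n u)) = \<phi> (stake (n + m) u)"
    by (simp flip: stake_add image_append)
  also have "\<dots> = stake (n * L + m * L) u" by (simp add: stake_eq distrib_right)
  also have "\<dots> = stake (n * L) u @ stake (m * L) (sdrop (n * L) u)" by (simp only: stake_add)
  finally show ?thesis by (simp add: stake_eq del: stake_add)
qed

lemma window_funpow: "(\<phi> ^^ k) (stake m (sdrop n u)) = stake (m * L ^ k) (sdrop (n * L ^ k) u)"
  by (induction k) (simp_all add: window mult.commute mult.left_commute)

lemma block: "stake L (sdrop (k * L) u) = \<phi> [u !! k]"
  using window[of 1 k] by (simp add: sdrop_simps)

lemma factor_image: "factor w u \<Longrightarrow> factor (\<phi> w) u"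
  by (metis factor_iff_stake factor_stake window)

lemma shifted_block:
  assumes "j \<le> L"
  shows "stake L (sdrop (k * L + j) u) = drop j (\<phi> [u !! k]) @ take j (\<phi> [u !! Suc k])"
proof -
  have "stake L (sdrop (k * L + j) u) = stake (L - j) (sdrop (k * L + j) u) @ stake j (sdrop (Suc k * L) u)"
    using assms stake_add[of "L - j" "sdrop (k * L + j) u" j] by (simp add: add.commute)
  also have "stake (L - j) (sdrop (k * L + j) u) = drop j (stake L (sdrop (k * L) u))"
    by (simp add: drop_stake)
  also have "stake j (sdrop (Suc k * L) u) = take j (stake L (sdrop (Suc k * L) u))"
    using assms by (simp add: take_stake min_absorb1)
  finally show ?thesis by (simp only: block)
qed

section \<open>Uniform recurrence\<close>

text \<open>A high power of \<open>\<phi>\<close> maps the first letter of \<open>u\<close> to a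
  prefix of \<open>u\<close> containing \<open>w\<close>. By primitivity that letter recurs with
  bounded gaps, hence so does its image.\<close>

lemma uniformly_recurrent:
  assumes "factor w u"
  shows "\<exists>N. \<forall>q. \<exists>i<N. stake (length w) (sdrop (q + i) u) = w"
proof -
  obtain n\<^sub>0 where n\<^sub>0: "stake (length w) (sdrop n\<^sub>0 u) = w"
    using assms unfolding factor_iff_stake by blast
  \<comment> \<open>A generous exponent: as \<open>L\<close> is at least 2, the prefix of length
    \<open>L ^ n\<close> covers the occurrence of \<open>w\<close> at
    \<open>n\<^sub>0\<close>.\<close>
  define n where "n = n\<^sub>0 + length w"
  define M where "M = L ^ n"
  have "n \<le> 2 ^ n" by (simp add: less_imp_le)
  also have "\<dots> \<le> L ^ n" using L_ge_2 by (rule power_mono) simp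
  finally have M: "n\<^sub>0 + length w \<le> M" by (simp add: M_def n_def)
  obtain \<kappa> where \<kappa>: "\<And>a b. a \<in> set ((\<phi> ^^ \<kappa>) [b])"
    using primitive unfolding primitive_morphism_def by blast
  define K where "K = L ^ \<kappa>"
  have letter: "\<exists>i<K. u !! (k * K + i) = u !! 0" for k
  proof -
    have "(\<phi> ^^ \<kappa>) [u !! k] = stake K (sdrop (k * K) u)"
      using window_funpow[of \<kappa> 1 k] by (simp add: K_def)
    with \<kappa>[of "u !! 0" "u !! k"] have "u !! 0 \<in> set (stake K (sdrop (k * K) u))" by simp
    then show ?thesis by (auto simp: in_set_conv_nth sdrop_snth)
  qed
  have occ: "stake (length w) (sdrop (r * M + n\<^sub>0) u) = w" if "u !! r = u !! 0" for r
  proof -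
    have "stake M (sdrop (r * M) u) = stake M u"
      using window_funpow[of n 1 r] window_funpow[of n 1 0] that by (simp add: M_def)
    then have "take (length w) (drop n\<^sub>0 (stake M (sdrop (r * M) u))) = take (length w) (drop n\<^sub>0 (stake M u))"
      by simp
    then show ?thesis using M n\<^sub>0
      by (simp add: take_stake drop_stake min_absorb1)
  qed
  have "K * M > 0" using L_ge_2 by (simp add: K_def M_def)
  have "\<exists>i<2 * (K * M) + n\<^sub>0 + 1. stake (length w) (sdrop (q + i) u) = w" for q
  proof -
    \<comment> \<open>The block of length \<open>K * M\<close> after the one containing
      \<open>q\<close>, so that the occurrence found does not start before \<open>q\<close>.\<close>
    define k where "k = Suc (q div (K * M))"
    obtain i where i: "i < K" "u !! (k * K + i) = u !! 0" using letter by blast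
    have "k * (K * M) = q div (K * M) * (K * M) + K * M" by (simp add: k_def)
    moreover have "q = q div (K * M) * (K * M) + q mod (K * M)" by (simp only: div_mult_mod_eq)
    moreover have "q mod (K * M) < K * M" using \<open>K * M > 0\<close> by simp
    moreover have "i * M \<le> K * M" using i by simp
    moreover have "(k * K + i) * M = k * (K * M) + i * M" by (simp add: algebra_simps)
    ultimately have "q \<le> (k * K + i) * M + n\<^sub>0" "(k * K + i) * M + n\<^sub>0 - q < 2 * (K * M) + n\<^sub>0 + 1"
      by linarith+
    with occ[OF i(2)] show ?thesis
      by (intro exI[of _ "(k * K + i) * M + n\<^sub>0 - q"]) simp
  qed
  then show ?thesis by blast
qed

section \<open>Consequences of aperiodicity and factors of length two\<close>

text \<open>Otherwise \<open>u\<close> would be a single block repeated forever.\<close>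

lemma letters_differ: "\<phi> [False] \<noteq> \<phi> [True]"
proof
  assume eq: "\<phi> [False] = \<phi> [True]"
  have same: "\<phi> [a] = \<phi> [False]" for a using eq by (cases a) auto
  have "u !! (n + L) = u !! n" for n
  proof -
    have "u !! (k * L + i) = \<phi> [False] ! i" if "i < L" for k i
    proof -
      have "u !! (k * L + i) = stake L (sdrop (k * L) u) ! i" using that by (simp add: sdrop_snth)
      then show ?thesis using same[of "u !! k"] by (simp add: block)
    qed
    from this[of "n mod L" "n div L"] this[of "n mod L" "Suc (n div L)"] L_ge_2
    show ?thesis by (simp add: add.commute add.left_commute)
  qed
  then have "snth (sdrop L u) = snth u" by (simp add: fun_eq_iff sdrop_snth add.commute)
  then have "sdrop L u = u" by (metis stream_smap_nats)
  then have "u = stake L u @- u" by (metis stake_sdrop)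
  moreover have "stake L u \<noteq> []" using L_ge_2 by (metis length_stake list.size(3) not_numeral_le_zero)
  ultimately have "u = [] @- cycle (stake L u)" using eq_cycleI by (metis shift.simps(1))
  then show False using aperiodic \<open>stake L u \<noteq> []\<close> unfolding aperiodic_def by blast
qed


lemma letter_recurs: "\<exists>i\<ge>q. u !! i = a"
proof -
  obtain \<kappa> where "\<And>a b. a \<in> set ((\<phi> ^^ \<kappa>) [b])"
    using primitive unfolding primitive_morphism_def by blast
  then have "a \<in> set (stake (L ^ \<kappa>) u)"
    using window_funpow[of \<kappa> 1 0] by (metis One_nat_def mult_0 nat_mult_1 sdrop.simps(1) stake.simps)
  then obtain n where "u !! n = a" by (auto simp: in_set_conv_nth)
  then have "factor [a] u" unfolding factor_iff_stake
    by (intro exI[of _ n]) (simp add: sdrop_simps)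
  from uniformly_recurrent[OF this] obtain i where "stake 1 (sdrop (q + i) u) = [a]" by auto
  then show ?thesis by (intro exI[of _ "q + i"]) (simp add: sdrop_simps)
qed

lemma factor_pair_iff: "factor [a, b] u \<longleftrightarrow> (\<exists>n. u !! n = a \<and> u !! Suc n = b)"
  unfolding factor_iff_stake by (simp add: sdrop_simps numeral_2_eq_2)

text \<open>Otherwise \<open>u\<close> would be constant from some \<open>a\<close> on, although the
  other letter recurs.\<close>

lemma factor_change: "factor [a, \<not> a] u"
proof (rule ccontr)
  assume neg: "\<not> ?thesis"
  obtain q where "u !! q = a" using letter_recurs by blast
  have "u !! (q + n) = a" for n
    using neg \<open>u !! q = a\<close> by (induction n) (auto simp: factor_pair_iff)
  moreover obtain r where "q \<le> r" "u !! r = (\<not> a)" using letter_recurs by blast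
  ultimately show False by (metis le_add_diff_inverse)
qed

text \<open>Otherwise the letters alternate and \<open>u\<close> has period 2. With the two changes
  of letter this provides three factors of length two.\<close>

lemma factor_square: "\<exists>c. factor [c, c] u"
proof (rule ccontr)
  assume "\<not> ?thesis"
  then have alt: "u !! Suc n = (\<not> u !! n)" for n by (auto simp: factor_pair_iff)
  have "u !! (2 + n) = u !! n" for n
    using alt[of n] alt[of "Suc n"] by (simp del: snth.simps)
  then have "snth (sdrop 2 u) = snth u" by (simp add: fun_eq_iff sdrop_snth del: sdrop.simps)
  then have "sdrop 2 u = u" by (metis stream_smap_nats)
  then have "u = stake 2 u @- u" by (metis stake_sdrop)
  moreover have ne: "stake 2 u \<noteq> []" by (simp add: numeral_2_eq_2)
  ultimately have "u = [] @- cycle (stake 2 u)" using eq_cycleI by (metis shift.simps(1))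
  then show False using aperiodic ne unfolding aperiodic_def by blast
qed

lemma pair_window:
  assumes "factor [a, b] u"
  shows "\<exists>N. \<forall>q. \<exists>i<N. u !! (q + i) = a \<and> u !! (q + Suc i) = b"
  using uniformly_recurrent[OF assms] by (simp add: sdrop_simps numeral_2_eq_2)

section \<open>Phase of an occurrence of blocks\<close>

text \<open>
  An occurrence of a concatenation of blocks of length \<^term>\<open>L\<close> has some phase \<open>j\<close> modulo
  \<^term>\<open>L\<close>. Since \<^term>\<open>u\<close> has at least three factors of length 2 but there are only two blocks,
  \<open>j\<close> lies in the common prefix or in the common suffix of the images of the letters.
\<close>

lemma desubstitution:
  assumes f: "\<And>a. length (f a) = L"
    and dec: "\<And>a. \<phi> [a] = x @ P a @ y"
    and ne: "P False \<noteq> []" "P True \<noteq> []"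
    and hd: "hd (P False) \<noteq> hd (P True)" and last: "last (P False) \<noteq> last (P True)"
    and ext: "\<And>n. \<exists>a b. n \<le> length (a @ v @ b) \<and> factor (concat (map f (a @ v @ b))) u"
  shows "\<exists>p s \<pi>. p @ s = y @ x \<and> (\<forall>a. f a = s @ P (\<pi> a) @ p) \<and> (\<pi> = id \<or> \<pi> = Not)
           \<and> factor (map \<pi> v) u"
proof -
  obtain c where c: "factor [c, c] u" using factor_square by blast
  obtain N1 where N1: "\<And>q. \<exists>i<N1. u !! (q + i) = False \<and> u !! (q + Suc i) = True"
    using pair_window[OF factor_change[of False]] by auto
  obtain N2 where N2: "\<And>q. \<exists>i<N2. u !! (q + i) = True \<and> u !! (q + Suc i) = False"
    using pair_window[OF factor_change[of True]] by auto
  obtain N3 where N3: "\<And>q. \<exists>i<N3. u !! (q + i) = c \<and> u !! (q + Suc i) = c"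
    using pair_window[OF c] by auto
  \<comment> \<open>The word around \<open>v\<close> is long enough for each of the three pairs of
    letters to occur among the blocks of \<open>u\<close> that it meets.\<close>
  obtain a b where len: "N1 + N2 + N3 \<le> length (a @ v @ b)"
    and fac: "factor (concat (map f (a @ v @ b))) u" using ext by blast
  define w where "w = a @ v @ b"
  obtain n where n: "stake (length (concat (map f w))) (sdrop n u) = concat (map f w)"
    using fac unfolding factor_iff_stake w_def by blast
  define k j where "k = n div L" and "j = n mod L"
  have n_eq: "n = k * L + j" by (simp add: k_def j_def)
  have "j < L" using L_ge_2 by (simp add: j_def)
  have blocks: "f (w ! i) = drop j (\<phi> [u !! (k + i)]) @ take j (\<phi> [u !! (k + Suc i)])"
    if i: "i < length w" for i
  proof -
    have lc: "length (concat (map f w)) = length w * L" using f by (rule length_concat_uniform)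
    have "f (w ! i) = take L (drop (i * L) (stake (length w * L) (sdrop n u)))"
      using nth_concat_uniform[of f, OF f i] by (simp only: n[unfolded lc])
    also have "\<dots> = stake (min L (length w * L - i * L)) (sdrop (n + i * L) u)"
      by (simp add: drop_stake take_stake)
    also have "min L (length w * L - i * L) = L"
      using i by (cases "length w - i") (simp_all flip: diff_mult_distrib)
    also have "n + i * L = (k + i) * L + j" by (simp add: n_eq algebra_simps)
    finally show ?thesis using shifted_block[of j "k + i"] \<open>j < L\<close> by simp
  qed
  \<comment> \<open>A window at phase \<open>j\<close> consists of the end \<open>D\<close> of one
    block of \<open>u\<close> and the beginning \<open>T\<close> of the next.\<close>
  define D T where "D a = drop j (\<phi> [a])" and "T a = take j (\<phi> [a])" for a
  have lenDT: "length (D a) = L - j" "length (T a) = min L j" for a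
    by (simp_all add: D_def T_def length_letter)
  have range: "\<exists>e. D a @ T b = f e" if "i < length w" "u !! (k + i) = a" "u !! (k + Suc i) = b" for i a b
    by (intro exI[of _ "w ! i"]) (simp only: D_def T_def blocks that)
  have "\<exists>e. D False @ T True = f e" "\<exists>e. D True @ T False = f e" "\<exists>e. D c @ T c = f e"
  proof -
    obtain i where "i < N1" "u !! (k + i) = False" "u !! (k + Suc i) = True" using N1 by blast
    then show "\<exists>e. D False @ T True = f e" using range[of i] len by (simp add: w_def del: snth.simps)
    obtain i where "i < N2" "u !! (k + i) = True" "u !! (k + Suc i) = False" using N2 by blast
    then show "\<exists>e. D True @ T False = f e" using range[of i] len by (simp add: w_def del: snth.simps)
    obtain i where "i < N3" "u !! (k + i) = c" "u !! (k + Suc i) = c" using N3 by blast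
    then show "\<exists>e. D c @ T c = f e" using range[of i] len by (simp add: w_def del: snth.simps)
  qed
  then obtain e1 e2 e3 where e: "D False @ T True = f e1" "D True @ T False = f e2" "D c @ T c = f e3"
    by blast
  have DT: "D False = D True \<or> T False = T True"
  proof (rule ccontr)
    assume "\<not> ?thesis"
    then show False using affix_agree_of_two_blocks[OF lenDT(1) e] by blast
  qed
  define m where "m = length (P False)"
  have m: "length (P a) = m" for a
    using length_letter[of a] length_letter[of False] dec[of a] dec[of False] by (simp add: m_def)
  have "m > 0" using ne by (simp add: m_def)
  have L: "L = length x + m + length y" using length_letter[of False] dec[of False] m by simp
  \<comment> \<open>At a phase strictly inside the middle part, \<open>T a\<close> would contain the
    first letter of \<open>P a\<close> and \<open>D a\<close> the last one. Both depend on
    \<open>a\<close>, against \<open>DT\<close>.\<close>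
  have j: "j \<le> length x \<or> length x + m \<le> j"
  proof (rule ccontr)
    assume no: "\<not> ?thesis"
    have "T a ! length x = hd (P a)" for a
      using no ne \<open>m > 0\<close> m[of a] by (simp add: T_def dec nth_append hd_conv_nth flip: length_greater_0_conv)
    moreover have "D a ! (length x + m - 1 - j) = last (P a)" for a
    proof -
      have "P a \<noteq> []" using ne by (cases a) auto
      have "D a ! (length x + m - 1 - j) = (x @ P a @ y) ! (length x + m - 1)"
        unfolding D_def dec using no L m[of a] by (subst nth_drop) simp_all
      also have "\<dots> = P a ! (m - 1)" using \<open>m > 0\<close> m[of a] by (cases m) (simp_all add: nth_append)
      finally show ?thesis using \<open>P a \<noteq> []\<close> m by (simp add: last_conv_nth)
    qed
    ultimately show False using DT hd last by metis
  qed
  \<comment> \<open>The window contains exactly one middle part: that of its first block if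
    \<open>j\<close> lies in \<open>x\<close> (\<open>d = 0\<close>), that of the second if
    \<open>j\<close> lies in \<open>y\<close> (\<open>d = 1\<close>).\<close>
  obtain p s d where ps: "p @ s = y @ x"
    and occ: "\<And>i. i < length w \<Longrightarrow> f (w ! i) = s @ P (u !! (k + d + i)) @ p"
  proof (cases "j \<le> length x")
    case True
    show ?thesis
      by (rule that[of "y @ take j x" "drop j x" 0])
        (use True blocks in \<open>simp_all add: dec\<close>)
  next
    case False
    then obtain i where i: "j = length x + (m + i)" using j by (metis le_Suc_ex add.assoc)
    show ?thesis
      by (rule that[of "take i y" "drop i y @ x" 1])
        (use i blocks m in \<open>simp_all add: dec\<close>)
  qed
  obtain i1 where i1: "i1 < length w" "u !! (k + d + i1) = False"
    using N1[of "k + d"] len unfolding w_def[symmetric] by (meson add_leD1 add_leD2 less_le_trans)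
  obtain i2 where i2: "i2 < length w" "u !! (k + d + i2) = True"
    using N2[of "k + d"] len unfolding w_def[symmetric] by (meson add_leD1 add_leD2 less_le_trans)
  have "P False \<noteq> P True" using hd by auto
  then have "f (w ! i1) \<noteq> f (w ! i2)" unfolding occ[OF i1(1)] occ[OF i2(1)] i1(2) i2(2) by simp
  then have wne: "w ! i1 \<noteq> w ! i2" by (rule contrapos_nn) (erule arg_cong)
  \<comment> \<open>\<open>w ! i2\<close> has the block with \<open>P True\<close> and
    \<open>w ! i1\<close>, the other letter, the one with \<open>P False\<close>; so this test is a
    permutation of the letters.\<close>
  define \<pi> where "\<pi> a = (a = w ! i2)" for a
  have f_eq: "f a = s @ P (\<pi> a) @ p" for a
  proof (cases "a = w ! i2")
    case False
    then have "a = w ! i1" using wne by auto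
    then show ?thesis using False occ[OF i1(1)] i1 by (simp add: \<pi>_def)
  qed (use occ[OF i2(1)] i2 in \<open>simp add: \<pi>_def\<close>)
  have "\<pi> = id \<or> \<pi> = Not" by (cases "w ! i2") (auto simp: \<pi>_def fun_eq_iff)
  moreover have "factor (map \<pi> w) u"
  proof -
    have "\<pi> (w ! i) = u !! (k + d + i)" if "i < length w" for i
      using occ[OF that] f_eq[of "w ! i"] \<open>P False \<noteq> P True\<close>
      by (cases "\<pi> (w ! i)"; cases "u !! (k + d + i)") auto
    then have "map \<pi> w = stake (length w) (sdrop (k + d) u)"
      by (intro nth_equalityI) (simp_all add: sdrop_snth)
    then show ?thesis by (simp add: factor_stake)
  qed
  then have "factor (map \<pi> v) u" unfolding w_def by (simp add: factor_infix)
  ultimately show ?thesis using ps f_eq by blast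
qed

section \<open>Closure of the factors under \<open>E\<close>\<close>

text \<open>There are finitely many words of each length, so some antipalindromic factor
  \<open>v\<close> is long enough to contain \<open>w\<close> by uniform recurrence; then
  \<open>E v = v\<close> contains \<open>E w\<close>.\<close>

lemma factor_E:
  assumes inf: "infinite {w. factor w u \<and> antipalindrome w}" and w: "factor w u"
  shows "factor (E w) u"
proof -
  obtain N where N: "\<And>q. \<exists>i<N. stake (length w) (sdrop (q + i) u) = w"
    using uniformly_recurrent[OF w] by blast
  have "finite {v :: word. length v \<le> N + length w}"
    using finite_lists_length_le[of "UNIV :: bool set"] by simp
  then obtain v where v: "factor v u" "antipalindrome v" "N + length w < length v"
    using inf by (metis (mono_tags, lifting) finite_subset mem_Collect_eq not_less subsetI)
  then obtain q where q: "stake (length v) (sdrop q u) = v" unfolding factor_iff_stake by blast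
  obtain i where i: "i < N" "stake (length w) (sdrop (q + i) u) = w" using N by blast
  have "w = take (length w) (drop i (stake (length v) (sdrop q u)))"
    using i v(3) by (simp add: take_stake drop_stake min_absorb1)
  then have "w = take (length w) (drop i v)" by (simp only: q)
  then have "v = take i v @ w @ drop (length w) (drop i v)" by (metis append_take_drop_id)
  then have "E v = E (drop (length w) (drop i v)) @ E w @ E (take i v)"
    by (metis E_append append.assoc)
  then show ?thesis using v factor_infix unfolding antipalindrome_def by metis
qed

end

section \<open>The conjugate in class A1\<close>

theorem theorem34:
  fixes \<phi> :: "word \<Rightarrow> word" and u :: "bool stream"
  assumes "primitive_morphism \<phi>" and "uniform_morphism \<phi>"
    and "fixed_point \<phi> u" and "aperiodic u"
    and "infinite {w. factor w u \<and> antipalindrome w}"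
  shows "\<exists>\<psi>. class_A1 \<psi> \<and> (conjugate \<phi> \<psi> \<or> conjugate (\<phi> \<circ> \<phi>) \<psi>)"
proof -
  interpret primitive_uniform_fixed_point \<phi> u by unfold_locales (rule assms)+
  have E_len: "length (E w) = length w" for w by (simp add: E_def)
  obtain x y P where dec: "\<And>a. \<phi> [a] = x @ P a @ y" and ne: "P False \<noteq> []" "P True \<noteq> []"
    and hd: "hd (P False) \<noteq> hd (P True)" and last: "last (P False) \<noteq> last (P True)"
    using common_affix_decomp[of "\<lambda>a. \<phi> [a]", OF length_letter letters_differ] by metis
  have Pne: "P a \<noteq> []" for a using ne by (cases a) auto
  have Plen: "length (P a) = length (P b)" for a b
    using length_letter[of a] length_letter[of b] by (simp add: dec)
  have E_image: "E (\<phi> w) = concat (map (\<lambda>a. E (\<phi> [a])) (rev w))" for w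
    by (subst eq_concat) (simp add: E_def rev_concat rev_map map_concat comp_def)
  have desub_E: "\<exists>p s \<pi>. p @ s = y @ x \<and> (\<forall>a. E (\<phi> [a]) = s @ P (\<pi> a) @ p) \<and> (\<pi> = id \<or> \<pi> = Not)
      \<and> factor (map \<pi> (rev v)) u" if v: "factor v u" for v
  proof (rule desubstitution[OF _ dec ne hd last])
    show "length (E (\<phi> [a])) = L" for a by (simp add: E_len length_letter)
    fix n
    \<comment> \<open>\<open>E\<close> reverses the order of the blocks, so extending
      \<open>v\<close> to the right extends \<open>rev v\<close> to the left.\<close>
    obtain v' where v': "factor (v @ v') u" "length v' = n" using factor_extend[OF v] by blast
    have "factor (E (\<phi> (v @ v'))) u" using factor_E[OF assms(5) factor_image[OF v'(1)]] .
    then show "\<exists>a b. n \<le> length (a @ rev v @ b) \<and> factor (concat (map (\<lambda>a. E (\<phi> [a])) (a @ rev v @ b))) u"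
      using v'(2) by (intro exI[of _ "rev v'"] exI[of _ "[]"]) (subst (asm) E_image, simp)
  qed
  show ?thesis
  \<comment> \<open>The data from \<open>desub_E\<close> may vary with \<open>v\<close>. Splitting
    on whether \<open>Not\<close> is ever possible leaves \<open>id\<close> for every
    \<open>v\<close> in the second case.\<close>
  proof (cases "\<exists>p s. p @ s = y @ x \<and> (\<forall>a. E (\<phi> [a]) = s @ P (\<not> a) @ p)")
    case True
    then obtain p s where ps: "p @ s = y @ x" and eq: "\<And>a. E (\<phi> [a]) = s @ P (\<not> a) @ p" by blast
    have eq': "s @ P (\<not> a) @ p = E y @ E (P a) @ E x" for a
      using eq[of a] by (simp add: dec E_append)
    have hdE: "hd (E (P a)) = (\<not> last (P a))" and Ene: "E (P a) \<noteq> []" for a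
      using Pne[of a] by (simp_all add: E_def hd_rev last_map)
    \<comment> \<open>Both sides branch right after their prefix: the first letter of
      \<open>E (P a)\<close> is the exchanged last letter of \<open>P a\<close>.\<close>
    have s: "s = E y"
      by (rule branching_prefix_unique[OF eq'[of False] eq'[of True]]) (use hd last hdE Ene Pne in auto)
    have P: "E (P a) = P (\<not> a)" and p: "p = E x" for a
      using eq'[of a] Plen[of "\<not> a" a] by (auto simp: s E_len)
    \<comment> \<open>Each image of \<open>\<phi>\<close> with \<open>x\<close> moved from its front
      to its end, which is conjugation by \<open>x\<close>.\<close>
    define \<psi> where "\<psi> w = concat (map (\<lambda>a. P a @ y @ x) w)" for w
    have "class_A1 \<psi>" unfolding class_A1_def
    proof (intro conjI exI)
      show "morphism \<psi>" by (simp add: morphism_def \<psi>_def)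
      show "antipalindrome (y @ x)" using ps by (simp add: antipalindrome_def E_append s p)
      show "\<psi> [False] = P False @ y @ x" "\<psi> [True] = E (P False) @ y @ x"
        by (simp_all add: \<psi>_def P)
    qed (rule ne)
    moreover have "x @ \<psi> w = \<phi> w @ x" for w
    proof (induction w)
      case (Cons a w)
      then show ?case using image_Cons[of a w] by (simp add: \<psi>_def dec)
    qed (simp add: \<psi>_def image_Nil)
    then have "conjugate \<phi> \<psi>" unfolding conjugate_def left_conjugate_def by blast
    ultimately show ?thesis by blast
  next
    case False
    have E_id: "\<exists>p s. p @ s = y @ x \<and> (\<forall>a. E (\<phi> [a]) = s @ P a @ p) \<and> factor (rev v) u"
      if "factor v u" for v
      using desub_E[OF that] False by fastforce
    \<comment> \<open>The exchange of letters is \<open>E\<close> after reversal.\<close>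
    have factor_Not: "factor (map Not v) u" if "factor v u" for v
      using factor_E[OF assms(5), of "rev v"] E_id[OF that] by (auto simp: E_def rev_map)
    have Nil_fac: "factor [] u" by (simp add: factor_iff_stake)
    have "\<exists>p s \<pi>. p @ s = y @ x \<and> (\<forall>a. map Not (\<phi> [a]) = s @ P (\<pi> a) @ p) \<and> (\<pi> = id \<or> \<pi> = Not)
      \<and> factor (map \<pi> []) u"
    proof (rule desubstitution[OF _ dec ne hd last])
      show "length (map Not (\<phi> [a])) = L" for a by (simp add: length_letter)
      fix n
      have "factor (map Not (\<phi> (stake n u))) u"
        using factor_Not[OF factor_image[OF factor_stake[of n 0]]] by simp
      then show "\<exists>a b. n \<le> length (a @ [] @ b) \<and> factor (concat (map (\<lambda>a. map Not (\<phi> [a])) (a @ [] @ b))) u"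
        by (intro exI[of _ "stake n u"] exI[of _ "[]"]) (subst (asm) eq_concat, simp add: map_concat comp_def)
    qed
    then obtain p s \<pi> where ps: "p @ s = y @ x" and eq: "\<And>a. map Not (\<phi> [a]) = s @ P (\<pi> a) @ p"
      and \<pi>: "\<pi> = id \<or> \<pi> = Not" by blast
    have eq': "s @ P (\<pi> a) @ p = map Not x @ map Not (P a) @ map Not y" for a
      using eq[of a] by (simp add: dec)
    have s: "s = map Not x"
      by (rule branching_prefix_unique[OF eq'[of False] eq'[of True]]) (use \<pi> hd Pne in \<open>auto simp: hd_map\<close>)
    have p: "p = map Not y" using eq'[of True] Plen[of "\<pi> True" True] by (simp add: s)
    have "map Not (y @ x) = y @ x" using ps s p by simp
    \<comment> \<open>Exchanging letters fixes no nonempty word; the same fact rules out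
      \<open>\<pi> = id\<close> below.\<close>
    then have "y @ x = []" by (cases "y @ x") auto
    then have xy: "x = []" "y = []" by auto
    have P: "\<phi> [a] = P a" for a using dec xy by simp
    have Not_P: "map Not (P a) = P (\<not> a)" for a
    proof -
      have "\<pi> = Not"
      proof (rule ccontr)
        assume "\<pi> \<noteq> Not"
        then have "map Not (P a) = P a" using \<pi> eq[of a] by (simp add: P s p xy)
        then show False using Pne[of a] by (cases "P a") auto
      qed
      then show ?thesis using eq[of a] by (simp add: P s p xy)
    qed
    have E_P: "E (P a) = P a" for a using E_id[OF Nil_fac] by (auto simp: P xy)
    have E_rev: "E (\<phi> w) = \<phi> (rev w)" for w
      by (subst E_image, subst eq_concat) (simp add: P E_P)
    \<comment> \<open>Reversal is \<open>E\<close> followed by the exchange of letters;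
      \<open>E\<close> fixes both blocks, so reversal swaps them.\<close>
    have "rev (P False) = map Not (E (P False))" by (simp add: E_def rev_map comp_def)
    then have "rev (P False) = P True" by (simp add: E_P Not_P)
    \<comment> \<open>The witnesses are \<open>\<phi> (P False)\<close> and the empty word:
      \<open>E\<close> turns the former into \<open>\<phi> (rev (P False))\<close>, which is
      \<open>\<phi> (P True)\<close>.\<close>
    have "class_A1 (\<phi> \<circ> \<phi>)" unfolding class_A1_def
    proof (intro conjI exI)
      show "morphism (\<phi> \<circ> \<phi>)" by (simp add: morphism_def image_append)
      show "antipalindrome []" by (simp add: antipalindrome_def E_def)
      show "\<phi> (P False) \<noteq> []"
        using length_image[of "P False"] L_ge_2 ne by (metis length_0_conv mult_is_0 not_numeral_le_zero)
      show "(\<phi> \<circ> \<phi>) [False] = \<phi> (P False) @ []" by (simp add: P)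
      show "(\<phi> \<circ> \<phi>) [True] = E (\<phi> (P False)) @ []"
        by (simp add: P E_rev \<open>rev (P False) = P True\<close>)
    qed
    moreover have "conjugate (\<phi> \<circ> \<phi>) (\<phi> \<circ> \<phi>)"
      unfolding conjugate_def left_conjugate_def by (intro disjI1 exI[of _ "[]"]) simp
    ultimately show ?thesis by blast
  qed
qed

end
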